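(* The signature $\Sigma_{SETAF}^{\mathit{cf}_{\mathcal L}}=\{\mathit{cf}_{\mathcal L}(F)\mid F\text{ a SETAF}\}$ is given by exactly all non-empty sets $\mathbb L$ of labellings such that: 1. all $\lambda\in\mathbb L$ have the same domain $\mathrm{Args}_{\mathbb L}$; 2. if $\lambda\in\mathbb L$ assigns one argument to $\mathrm{out}$ then it also assigns an argument to $\mathrm{in}$; 3. for $\lambda\in\mathbb L$ and $C\subseteq\lambda_{\mathrm{in}}$ also $(C,\emptyset,\mathrm{Args}_{\mathbb L}\setminus C)\in\mathbb L$; 4. for $\lambda\in\mathbb L$ and $C\subseteq\lambda_{\mathrm{out}}$ also $(\lambda_{\mathrm{in}},\lambda_{\mathrm{out}}\setminus C,\lambda_{\mathrm{undec}}\cup C)\in\mathbb L$; 5. for $\lambda,\lambda'\in\mathbb L$ with $\lambda_{\mathrm{in}}\subseteq\lambda'_{\mathrm{in}}$ also $(\lambda'_{\mathrm{in}},\lambda_{\mathrm{out}}\cup\lambda'_{\mathrm{out}},\lambda_{\mathrm{undec}}\cap\lambda'_{\mathrm{undec}})\in\mathbb L$; 6. for $\lambda,\lambda'\in\mathbb L$ and $C\subseteq\lambda_{\mathrm{out}}$ with $C\neq\emptyset$ we have $\lambda_{\mathrm{in}}\cup C\not\subseteq\lambda'_{\mathrm{in}}$.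
   Context: A SETAF is a pair $F=(A,R)$ with $A$ a finite set (of arguments) and $R\subseteq(2^A\setminus\{\emptyset\})\times A$. A labelling of $F$ is a total function $\lambda:A\to\{\mathrm{in},\mathrm{out},\mathrm{undec}\}$; $\lambda_x=\{a\in A\mid\lambda(a)=x\}$, and $\lambda$ is also written as the triple $(\lambda_{\mathrm{in}},\lambda_{\mathrm{out}},\lambda_{\mathrm{undec}})$. In general, a labelling is such a function on some finite set of arguments (its domain). A labelling $\lambda$ is conflict-free in $F$ if (i) for all $(B,a)\in R$, either $\lambda(a)\neq\mathrm{in}$ or there is $b\in B$ with $\lambda(b)\ne\mathrm{in}$; and (ii) for all $a\in A$, if $\lambda(a)=\mathrm{out}$ then there is $(B,a)\in R$ with $\lambda(b)=\mathrm{in}$ for all $b\in B$. $\mathit{cf}_{\mathcal L}(F)$ is the set of all conflict-free labellings of $F$. *)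

theory Defs
  imports Main
begin

type_synonym 'a setaf = "'a set \<times> ('a set \<times> 'a) set"

definition is_setaf :: "'a setaf \<Rightarrow> bool" where
  "is_setaf F \<longleftrightarrow> (case F of (A, R) \<Rightarrow> finite A \<and> R \<subseteq> (Pow A - {{}}) \<times> A)"

datatype label = In | Out | Undec

text \<open>A labelling on a finite set \<open>A\<close> is a partial map with domain exactly \<open>A\<close>, so that
  the labelling determines its domain.\<close>

type_synonym 'a labelling = "'a \<rightharpoonup> label"

definition is_labelling :: "'a labelling \<Rightarrow> bool" where
  "is_labelling l \<longleftrightarrow> finite (dom l)"

definition lab :: "'a labelling \<Rightarrow> label \<Rightarrow> 'a set" where
  "lab l x = {a \<in> dom l. l a = Some x}"

text \<open>A labelling is identified with its triple. A triple of sets is the triple of some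
  labelling only if the three sets are pairwise disjoint, and the domain is then their union;
  \<open>(I, J, U) \<in> triple ` L\<close> states that the labelling written \<open>(I, J, U)\<close> exists and
  belongs to \<open>L\<close>.\<close>

definition triple :: "'a labelling \<Rightarrow> 'a set \<times> 'a set \<times> 'a set" where
  "triple l = (lab l In, lab l Out, lab l Undec)"

definition labelling_of :: "'a setaf \<Rightarrow> 'a labelling \<Rightarrow> bool" where
  "labelling_of F l \<longleftrightarrow> is_labelling l \<and> dom l = fst F"

definition conflict_free :: "'a setaf \<Rightarrow> 'a labelling \<Rightarrow> bool" where
  "conflict_free F l \<longleftrightarrow> (case F of (A, R) \<Rightarrow>
     (\<forall>(B, a) \<in> R. l a \<noteq> Some In \<or> (\<exists>b\<in>B. l b \<noteq> Some In)) \<and>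
     (\<forall>a\<in>A. l a = Some Out \<longrightarrow> (\<exists>B. (B, a) \<in> R \<and> (\<forall>b\<in>B. l b = Some In))))"

definition cf_labellings :: "'a setaf \<Rightarrow> 'a labelling set" where
  "cf_labellings F = {l. labelling_of F l \<and> conflict_free F l}"

definition cf_signature :: "'a labelling set set" where
  "cf_signature = {cf_labellings F | F. is_setaf F}"

text \<open>The common domain of the labellings in \<open>L\<close>, when they have one.\<close>

definition Args :: "'a labelling set \<Rightarrow> 'a set" where
  "Args L = (\<Union>l\<in>L. dom l)"

end

theory Submission
  imports Defs
begin

text \<open>For the realizability direction, let the attacks be all pairs \<open>(lab l In, a)\<close> with
  \<open>l \<in> L\<close> and \<open>l a = Out\<close>, together with all pairs \<open>(B, a)\<close> with \<open>a \<in> B\<close>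
  where \<open>B\<close> is not the in-set of any member of \<open>L\<close>. The second kind restricts the
  in-sets to those of \<open>L\<close> and never justifies an out-label. Given a conflict-free labelling, its
  out-arguments are therefore justified by members of \<open>L\<close> with smaller in-sets. Condition 5
  merges these into one member of \<open>L\<close>, whose superfluous out-labels condition 4 removes.\<close>

lemma mem_lab_iff [simp]: "a \<in> lab l x \<longleftrightarrow> l a = Some x"
  by (auto simp: lab_def)

lemma dom_eq_labs: "dom l = lab l In \<union> lab l Out \<union> lab l Undec"
  by (auto simp: lab_def) (metis label.exhaust)

lemma labelling_eqI:
  assumes "lab l In = lab m In" "lab l Out = lab m Out" "lab l Undec = lab m Undec"
  shows "l = m"
proof
  fix a
  have "l a = Some x \<longleftrightarrow> m a = Some x" for x
    using assms by (cases x) (metis mem_lab_iff)+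
  then show "l a = m a"
    by (metis not_Some_eq)
qed

lemma triple_mem_iff:
  "(I, J, U) \<in> triple ` L \<longleftrightarrow> (\<exists>l\<in>L. lab l In = I \<and> lab l Out = J \<and> lab l Undec = U)"
  by (auto simp: triple_def image_iff)

lemma ex_labelling_of_triple:
  assumes "I \<inter> J = {}" "I \<inter> U = {}" "J \<inter> U = {}"
  obtains l where "lab l In = I" "lab l Out = J" "lab l Undec = U"
proof
  let ?l = "\<lambda>a. if a \<in> I then Some In else if a \<in> J then Some Out
    else if a \<in> U then Some Undec else None"
  show "lab ?l In = I" "lab ?l Out = J" "lab ?l Undec = U"
    using assms by (auto simp: lab_def split: if_splits)
qed

text \<open>Both clauses of conflict-freeness become inclusions in the in-set. The first is antitone
  in \<open>lab l In\<close>, the second monotone, and the closure arguments below rest on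
  this.\<close>

lemma cf_labellings_iff:
  assumes "finite A"
  shows "l \<in> cf_labellings (A, R) \<longleftrightarrow> dom l = A \<and>
    (\<forall>(B, a)\<in>R. \<not> insert a B \<subseteq> lab l In) \<and>
    (\<forall>a\<in>lab l Out. \<exists>B. (B, a) \<in> R \<and> B \<subseteq> lab l In)"
proof -
  have "l a \<noteq> Some In \<or> (\<exists>b\<in>B. l b \<noteq> Some In) \<longleftrightarrow> \<not> insert a B \<subseteq> lab l In" for B a
    by auto
  moreover have "(\<forall>b\<in>B. l b = Some In) \<longleftrightarrow> B \<subseteq> lab l In" for B
    by auto
  moreover have "(\<forall>a\<in>dom l. l a = Some Out \<longrightarrow> P a) \<longleftrightarrow> (\<forall>a\<in>lab l Out. P a)" for P
    by auto
  ultimately show ?thesis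
    using assms
    by (auto simp: cf_labellings_def labelling_of_def is_labelling_def conflict_free_def
        simp del: insert_subset)
qed

text \<open>Conditions 3 to 5 all assert that some triple belongs to the set, so each of them
  reduces to these premises.\<close>

lemma triple_mem_cf_labellings:
  assumes "finite A" "I \<inter> J = {}" "I \<inter> U = {}" "J \<inter> U = {}" "I \<union> J \<union> U = A"
    and "\<And>B a. (B, a) \<in> R \<Longrightarrow> \<not> insert a B \<subseteq> I"
    and "\<And>a. a \<in> J \<Longrightarrow> \<exists>B. (B, a) \<in> R \<and> B \<subseteq> I"
  shows "(I, J, U) \<in> triple ` cf_labellings (A, R)"
proof -
  obtain l where l: "lab l In = I" "lab l Out = J" "lab l Undec = U"
    using assms(2-4) by (rule ex_labelling_of_triple)
  have "l \<in> cf_labellings (A, R)"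
    unfolding cf_labellings_iff[OF assms(1)] dom_eq_labs l using assms(5-7) by blast
  with l show ?thesis
    unfolding triple_mem_iff by blast
qed

definition cf_closed :: "'a labelling set \<Rightarrow> bool" where
  "cf_closed L \<longleftrightarrow> L \<noteq> {} \<and> (\<forall>l\<in>L. is_labelling l) \<and>
      (\<forall>l\<in>L. dom l = Args L) \<and>
      (\<forall>l\<in>L. lab l Out \<noteq> {} \<longrightarrow> lab l In \<noteq> {}) \<and>
      (\<forall>l\<in>L. \<forall>C. C \<subseteq> lab l In \<longrightarrow> (C, {}, Args L - C) \<in> triple ` L) \<and>
      (\<forall>l\<in>L. \<forall>C. C \<subseteq> lab l Out \<longrightarrow>
        (lab l In, lab l Out - C, lab l Undec \<union> C) \<in> triple ` L) \<and>
      (\<forall>l\<in>L. \<forall>l'\<in>L. lab l In \<subseteq> lab l' In \<longrightarrow>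
        (lab l' In, lab l Out \<union> lab l' Out, lab l Undec \<inter> lab l' Undec) \<in> triple ` L) \<and>
      (\<forall>l\<in>L. \<forall>l'\<in>L. \<forall>C. C \<subseteq> lab l Out \<and> C \<noteq> {} \<longrightarrow>
        \<not> lab l In \<union> C \<subseteq> lab l' In)"

text \<open>Shrinking the in-set creates no conflict, dropping out-labels only removes obligations,
  and a justifying attack survives when the in-set grows. Conditions 5 and 6 use one more fact: if
  \<open>B\<close> justifies \<open>a\<close> being out and \<open>B\<close> lies inside another
  conflict-free in-set, then \<open>a\<close> does not belong to that in-set.\<close>

lemma cf_closed_cf_labellings:
  assumes "is_setaf F"
  shows "cf_closed (cf_labellings F)"
proof -
  obtain A R where F: "F = (A, R)"
    by fastforce
  have fin: "finite A" and R: "R \<subseteq> (Pow A - {{}}) \<times> A"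
    using assms by (auto simp: F is_setaf_def)
  let ?L = "cf_labellings (A, R)"
  note iff = cf_labellings_iff[OF fin]
  have dom: "dom l = A"
    and labs: "lab l In \<union> lab l Out \<union> lab l Undec = A"
    and conflict: "\<And>B a. (B, a) \<in> R \<Longrightarrow> \<not> insert a B \<subseteq> lab l In"
    and just: "\<And>a. a \<in> lab l Out \<Longrightarrow> \<exists>B. (B, a) \<in> R \<and> B \<subseteq> lab l In"
    if "l \<in> ?L" for l
    using that iff[of l R] dom_eq_labs[of l] by blast+
  have disj: "lab l In \<inter> lab l Out = {}" "lab l In \<inter> lab l Undec = {}"
    "lab l Out \<inter> lab l Undec = {}" for l :: "'a labelling"
    by auto
  \<comment> \<open>The all-undecided labelling is always conflict-free, since
    \<open>insert a B\<close> is never empty.\<close>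
  have "({}, {}, A) \<in> triple ` ?L"
    using R by (intro triple_mem_cf_labellings[OF fin]) auto
  then have nonempty: "?L \<noteq> {}"
    by blast
  then have Args: "Args ?L = A"
    using dom by (auto simp: Args_def)
  \<comment> \<open>An out-label is justified by some \<open>B\<close> inside the in-set, and
    attacking sets are non-empty.\<close>
  have 2: "lab l In \<noteq> {}" if "l \<in> ?L" "lab l Out \<noteq> {}" for l
    using just[OF that(1)] that(2) R by blast
  have 3: "(C, {}, A - C) \<in> triple ` ?L" if "l \<in> ?L" "C \<subseteq> lab l In" for l C
    using labs[OF that(1)] conflict[OF that(1)] that(2)
    by (intro triple_mem_cf_labellings[OF fin]) blast+
  have 4: "(lab l In, lab l Out - C, lab l Undec \<union> C) \<in> triple ` ?L"
    if "l \<in> ?L" "C \<subseteq> lab l Out" for l C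
    using labs[OF that(1)] conflict[OF that(1)] just[OF that(1)] that(2) disj[of l]
    by (intro triple_mem_cf_labellings[OF fin]) blast+
  have 5: "(lab m In, lab l Out \<union> lab m Out, lab l Undec \<inter> lab m Undec) \<in> triple ` ?L"
    if "l \<in> ?L" "m \<in> ?L" "lab l In \<subseteq> lab m In" for l m
  proof (rule triple_mem_cf_labellings[OF fin])
    \<comment> \<open>An attack justifying an out-label of \<open>l\<close> has its source in
      \<open>lab m In\<close> too, so its target cannot be in for \<open>m\<close>.\<close>
    have "lab m In \<inter> lab l Out = {}"
      using just[OF that(1)] conflict[OF that(2)] that(3) by blast
    then show "lab m In \<inter> (lab l Out \<union> lab m Out) = {}"
      using disj[of m] by blast
    show "lab m In \<union> (lab l Out \<union> lab m Out) \<union> (lab l Undec \<inter> lab m Undec) = A"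
      using labs[OF that(1)] labs[OF that(2)] that(3) by blast
    show "\<exists>B. (B, a) \<in> R \<and> B \<subseteq> lab m In" if "a \<in> lab l Out \<union> lab m Out" for a
      using that just[OF \<open>l \<in> ?L\<close>] just[OF \<open>m \<in> ?L\<close>] \<open>lab l In \<subseteq> lab m In\<close> by blast
  next
    show "\<not> insert a B \<subseteq> lab m In" if "(B, a) \<in> R" for B a
      using conflict[OF \<open>m \<in> ?L\<close> that] .
  qed (use disj[of l] disj[of m] in blast)+
  have 6: "\<not> lab l In \<union> C \<subseteq> lab m In"
    if "l \<in> ?L" "m \<in> ?L" "C \<subseteq> lab l Out" "C \<noteq> {}" for l m C
    using just[OF that(1)] conflict[OF that(2)] that(3,4) by blast
  have fin_lab: "is_labelling l" if "l \<in> ?L" for l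
    using dom[OF that] fin by (simp add: is_labelling_def)
  show ?thesis
    unfolding cf_closed_def F Args
    by (intro conjI ballI allI impI nonempty fin_lab dom 2 3 4 5) (use 6 in blast)+
qed

lemma cf_closed_realizable:
  assumes "cf_closed L"
  shows "\<exists>F. is_setaf F \<and> cf_labellings F = L"
proof -
  note nonempty = assms[unfolded cf_closed_def, THEN conjunct1]
  note closed0 = assms[unfolded cf_closed_def, THEN conjunct2]
  note closed1 = closed0[THEN conjunct2]
  note closed2 = closed1[THEN conjunct2]
  note closed3 = closed2[THEN conjunct2]
  note closed4 = closed3[THEN conjunct2]
  note closed5 = closed4[THEN conjunct2]
  note closed6 = closed5[THEN conjunct2]
  note dom = closed1[THEN conjunct1, rule_format]
  have fin: "finite (Args L)"
    using nonempty dom closed0[THEN conjunct1] by (metis all_not_in_conv is_labelling_def)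
  have 2: "lab l In \<noteq> {}" if "l \<in> L" "lab l Out \<noteq> {}" for l
    using closed2[THEN conjunct1] that by blast
  have 3: "\<exists>m\<in>L. lab m In = C \<and> lab m Out = {}" if "l \<in> L" "C \<subseteq> lab l In" for l C
  proof -
    have "(C, {}, Args L - C) \<in> triple ` L"
      using closed3[THEN conjunct1] that by blast
    then show ?thesis
      unfolding triple_mem_iff by blast
  qed
  have 4: "\<exists>m\<in>L. lab m In = lab l In \<and> lab m Out = lab l Out - C
      \<and> lab m Undec = lab l Undec \<union> C" if "l \<in> L" "C \<subseteq> lab l Out" for l C
    unfolding triple_mem_iff[symmetric] using closed4[THEN conjunct1] that by blast
  have 5: "\<exists>k\<in>L. lab k In = lab m In \<and> lab k Out = lab l Out \<union> lab m Out"
    if "l \<in> L" "m \<in> L" "lab l In \<subseteq> lab m In" for l m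
  proof -
    have "(lab m In, lab l Out \<union> lab m Out, lab l Undec \<inter> lab m Undec) \<in> triple ` L"
      using closed5[THEN conjunct1] that by blast
    then show ?thesis
      unfolding triple_mem_iff by blast
  qed
  \<comment> \<open>Singletons \<open>C\<close> suffice: this says exactly that no member of
    \<open>L\<close> violates an attack of the first kind.\<close>
  have 6: "\<not> insert a (lab l In) \<subseteq> lab m In" if "l \<in> L" "m \<in> L" "a \<in> lab l Out" for l m a
  proof -
    have "{a} \<subseteq> lab l Out \<and> {a} \<noteq> {}"
      using that(3) by simp
    with closed6 that(1,2) have "\<not> lab l In \<union> {a} \<subseteq> lab m In"
      by blast
    then show ?thesis
      by simp
  qed
  have sub: "lab l x \<subseteq> Args L" if "l \<in> L" for l x
    using dom[OF that] by (auto simp: lab_def)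
  \<comment> \<open>In the second kind \<open>a \<in> B\<close>, so \<open>insert a B = B\<close>:
    such a pair forbids in-sets containing \<open>B\<close>, and it cannot justify \<open>a\<close>
    being out because \<open>B\<close> would then have to be in.\<close>
  define R where "R = {(lab l In, a) | l a. l \<in> L \<and> a \<in> lab l Out} \<union>
    {(B, a). B \<subseteq> Args L \<and> a \<in> B \<and> (\<forall>l\<in>L. lab l In \<noteq> B)}"
  have R_cases: "(\<exists>l\<in>L. B = lab l In \<and> a \<in> lab l Out) \<or>
      (B \<subseteq> Args L \<and> a \<in> B \<and> (\<forall>l\<in>L. lab l In \<noteq> B))" if "(B, a) \<in> R" for B a
    using that unfolding R_def by blast
  have setaf: "is_setaf (Args L, R)"
  proof -
    have "(B, a) \<in> (Pow (Args L) - {{}}) \<times> Args L" if "(B, a) \<in> R" for B a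
      using R_cases[OF that]
    proof
      assume "\<exists>l\<in>L. B = lab l In \<and> a \<in> lab l Out"
      then obtain l where l: "l \<in> L" "B = lab l In" "a \<in> lab l Out"
        by blast
      \<comment> \<open>Condition 2 is what keeps attacking sets of the first kind
        non-empty.\<close>
      then have "B \<noteq> {}"
        using 2[of l] by blast
      with l show ?thesis
        using sub[OF l(1)] by blast
    qed blast
    then have "R \<subseteq> (Pow (Args L) - {{}}) \<times> Args L"
      by (rule subrelI)
    with fin show ?thesis
      by (simp add: is_setaf_def)
  qed
  have "l \<in> L" if l: "l \<in> cf_labellings (Args L, R)" for l
  proof -
    note l' = l[unfolded cf_labellings_iff[OF fin]]
    note dom_l = l'[THEN conjunct1]
    have conflict: "\<not> insert a B \<subseteq> lab l In" if "(B, a) \<in> R" for B a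
      using l'[THEN conjunct2, THEN conjunct1] that by blast
    note just = l'[THEN conjunct2, THEN conjunct2, rule_format]
    have "\<exists>m\<in>L. lab m In = lab l In"
    \<comment> \<open>The empty set contains no \<open>a\<close> to carry an attack of the second
      kind; it is an in-set by condition 3 with \<open>C = {}\<close>.\<close>
    proof (cases "lab l In = {}")
      case True
      then show ?thesis
        using nonempty 3 by (metis all_not_in_conv empty_subsetI)
    next
      case False
      then obtain a where a: "a \<in> lab l In"
        by blast
      have "lab l In \<subseteq> Args L"
        using dom_l by (auto simp: lab_def)
      moreover have "(lab l In, a) \<notin> R"
        using conflict a by blast
      ultimately show ?thesis
        using a unfolding R_def by blast
    qed
    then obtain m0 where m0: "m0 \<in> L" "lab m0 In = lab l In"
      by blast
    have "finite (lab l Out)"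
      using dom_l fin by (simp add: lab_def)
    then have "\<exists>m\<in>L. lab m In = lab l In \<and> lab l Out \<subseteq> lab m Out"
    \<comment> \<open>Induction over subsets of \<open>lab l Out\<close> keeps the inserted
      \<open>a\<close> an out-argument of \<open>l\<close>, so that an attack on it is
      available.\<close>
    proof (induction rule: finite_subset_induct'[OF _ subset_refl, consumes 1, case_names empty insert])
      case empty
      then show ?case
        using m0 by blast
    next
      case (insert a S)
      then obtain m where m: "m \<in> L" "lab m In = lab l In" "S \<subseteq> lab m Out"
        by blast
      obtain B where B: "(B, a) \<in> R" "B \<subseteq> lab l In"
        using just insert.hyps by blast
      \<comment> \<open>\<open>B\<close> is all in and \<open>a\<close> is out, which rules out the
        second kind of attack.\<close>
      have "a \<notin> B"
        using B insert.hyps by auto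
      then obtain k where k: "k \<in> L" "B = lab k In" "a \<in> lab k Out"
        using R_cases[OF B(1)] by blast
      \<comment> \<open>Since \<open>lab k In = B\<close> lies in \<open>lab m In\<close>, condition
        5 adds the out-labels of \<open>k\<close> to \<open>m\<close> without changing its
        in-set.\<close>
      then obtain n where "n \<in> L" "lab n In = lab m In" "lab n Out = lab k Out \<union> lab m Out"
        using 5[of k m] m B by blast
      then show ?case
        using m k by blast
    qed
    then obtain m where m: "m \<in> L" "lab m In = lab l In" "lab l Out \<subseteq> lab m Out"
      by blast
    obtain n where n: "n \<in> L" "lab n In = lab m In" "lab n Out = lab m Out - (lab m Out - lab l Out)"
      using 4[OF m(1), of "lab m Out - lab l Out"] by blast
    have same: "lab n In = lab l In" "lab n Out = lab l Out"
      using m n by auto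
    \<comment> \<open>Over the common domain \<open>Args L\<close>, the in-set and out-set determine
      the labelling.\<close>
    have "lab n Undec = dom n - lab n In - lab n Out" for n :: "'a labelling"
      unfolding dom_eq_labs by auto
    then have "lab n Undec = lab l Undec"
      using same dom[OF n(1)] dom_l by metis
    with same have "n = l"
      by (intro labelling_eqI)
    with n show ?thesis
      by blast
  qed
  moreover have "l \<in> cf_labellings (Args L, R)" if "l \<in> L" for l
  proof -
    have "\<not> insert a B \<subseteq> lab l In" if "(B, a) \<in> R" for B a
      using R_cases[OF that]
    proof
      assume "\<exists>k\<in>L. B = lab k In \<and> a \<in> lab k Out"
      then show ?thesis
        using 6 \<open>l \<in> L\<close> by blast
    next
      \<comment> \<open>By condition 3 the in-sets of \<open>L\<close> are closed under subsets, so
        a \<open>B\<close> that is no in-set lies in none.\<close>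
      assume "B \<subseteq> Args L \<and> a \<in> B \<and> (\<forall>k\<in>L. lab k In \<noteq> B)"
      then show ?thesis
        using 3[OF \<open>l \<in> L\<close>, of B] by blast
    qed
    moreover have "(lab l In, a) \<in> R" if "a \<in> lab l Out" for a
      using \<open>l \<in> L\<close> that unfolding R_def by blast
    ultimately show ?thesis
      unfolding cf_labellings_iff[OF fin] using dom[OF that] by blast
  qed
  ultimately have "cf_labellings (Args L, R) = L"
    by blast
  with setaf show ?thesis
    by blast
qed

theorem proposition5:
  "(cf_signature :: 'a labelling set set) =
    {L. L \<noteq> {} \<and> (\<forall>l\<in>L. is_labelling l) \<and>
      (\<forall>l\<in>L. dom l = Args L) \<and>
      (\<forall>l\<in>L. lab l Out \<noteq> {} \<longrightarrow> lab l In \<noteq> {}) \<and>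
      (\<forall>l\<in>L. \<forall>C. C \<subseteq> lab l In \<longrightarrow> (C, {}, Args L - C) \<in> triple ` L) \<and>
      (\<forall>l\<in>L. \<forall>C. C \<subseteq> lab l Out \<longrightarrow>
        (lab l In, lab l Out - C, lab l Undec \<union> C) \<in> triple ` L) \<and>
      (\<forall>l\<in>L. \<forall>l'\<in>L. lab l In \<subseteq> lab l' In \<longrightarrow>
        (lab l' In, lab l Out \<union> lab l' Out, lab l Undec \<inter> lab l' Undec) \<in> triple ` L) \<and>
      (\<forall>l\<in>L. \<forall>l'\<in>L. \<forall>C. C \<subseteq> lab l Out \<and> C \<noteq> {} \<longrightarrow>
        \<not> lab l In \<union> C \<subseteq> lab l' In)}"
  unfolding cf_signature_def cf_closed_def[symmetric]
  using cf_closed_cf_labellings cf_closed_realizable by blast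

end
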